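(* For every $n\in\mathbb{N}$ the following relations hold in $U$: $$[y,(xxyy)^n]_{q^2}=(q^2-q^{-2})y(xxyy)^n,$$ $$[(yyxx)^n,y]_{q^2}=(q^2-q^{-2})(yyxx)^ny,$$ $$[y,(xxyy)^nxx]=(1-q^{-4})\left(yxx(yyxx)^n-(xxyy)^nxxy\right),$$ $$[(yyxx)^nyy,y]=0.$$
   Context: Let $\mathbb{F}$ be a field of characteristic zero and let $q\in\mathbb{F}$ be nonzero and not a root of unity; $\mathbb{N}=\{0,1,2,\ldots\}$. Let $\mathbb{V}$ be the free associative unital $\mathbb{F}$-algebra on two noncommuting generators (letters) $x,y$; the words in $x,y$ (including the trivial word $\mathbf{1}$) form a basis of $\mathbb{V}$. Words such as $(xxyy)^nx$ are written with respect to the free (concatenation) product. The $q$-shuffle product $\star$ on the vector space $\mathbb{V}$ is the bilinear associative product with unit $\mathbf{1}$ determined as follows. Put $\langle x,x\rangle=\langle y,y\rangle=2$ and $\langle x,y\rangle=\langle y,x\rangle=-2$. For nontrivial words $u=u_1\cdots u_r$ and $v=v_1\cdots v_s$, $$u\star v=u_1\big((u_2\cdots u_r)\star v\big)+v_1\big(u\star(v_2\cdots v_s)\big)q^{\langle v_1,u_1\rangle+\cdots+\langle v_1,u_r\rangle}.$$ $U$ denotes the subalgebra of $(\mathbb{V},\star)$ generated by $x,y$; all the words in the statement lie in $U$. Commutators are taken with respect to $\star$: $[X,Y]=X\star Y-Y\star X$ and $[X,Y]_{q^2}=q^2X\star Y-q^{-2}Y\star X$. *)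

theory Defs
  imports Complex_Main "HOL-Library.Poly_Mapping"
begin

(* Lists form a monoid under concatenation.  Hence, by the convolution product of
   Poly_Mapping, the finitely supported functions on words are the free associative unital
   algebra, whose product, unit and powers are the ring operations of the library. *)

instantiation list :: (type) monoid_add
begin

definition zero_list :: "'a list" where "0 = []"

definition plus_list :: "'a list \<Rightarrow> 'a list \<Rightarrow> 'a list" where "u + v = u @ v"

instance by standard (simp_all add: zero_list_def plus_list_def)

end

datatype letter = LetterX | LetterY

type_synonym 'f free_alg = "letter list \<Rightarrow>\<^sub>0 'f"

definition word :: "letter list \<Rightarrow> 'f::field free_alg" where
  "word w = Poly_Mapping.single w 1"

abbreviation gen_x :: "'f::field free_alg" where "gen_x \<equiv> word [LetterX]"

abbreviation gen_y :: "'f::field free_alg" where "gen_y \<equiv> word [LetterY]"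

definition scale :: "'f::field \<Rightarrow> 'f free_alg \<Rightarrow> 'f free_alg" (infixr "*\<^sub>F" 75) where
  "c *\<^sub>F f = Poly_Mapping.map (\<lambda>a. c * a) f"

definition pairing :: "letter \<Rightarrow> letter \<Rightarrow> int" where
  "pairing a b = (if a = b then 2 else - 2)"

fun qshuffle_words :: "'f::field \<Rightarrow> letter list \<Rightarrow> letter list \<Rightarrow> 'f free_alg" where
  "qshuffle_words q [] v = word v"
| "qshuffle_words q (a # u) [] = word (a # u)"
| "qshuffle_words q (a # u) (b # v) =
     word [a] * qshuffle_words q u (b # v)
     + q powi (\<Sum>c\<leftarrow>a # u. pairing b c) *\<^sub>F (word [b] * qshuffle_words q (a # u) v)"

definition qshuffle :: "'f::field free_alg \<Rightarrow> 'f \<Rightarrow> 'f free_alg \<Rightarrow> 'f free_alg"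
    ("(_ \<star>\<^bsub>_\<^esub> _)" [71, 0, 71] 70) where
  "f \<star>\<^bsub>q\<^esub> g = (\<Sum>u\<in>Poly_Mapping.keys f. \<Sum>v\<in>Poly_Mapping.keys g.
      (Poly_Mapping.lookup f u * Poly_Mapping.lookup g v) *\<^sub>F qshuffle_words q u v)"

definition qshuffle_comm :: "'f::field \<Rightarrow> 'f free_alg \<Rightarrow> 'f free_alg \<Rightarrow> 'f free_alg" where
  "qshuffle_comm q f g = f \<star>\<^bsub>q\<^esub> g - g \<star>\<^bsub>q\<^esub> f"

(* The commutator written with the subscript q^2. *)
definition qshuffle_comm_q2 :: "'f::field \<Rightarrow> 'f free_alg \<Rightarrow> 'f free_alg \<Rightarrow> 'f free_alg" where
  "qshuffle_comm_q2 q f g =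
     q powi 2 *\<^sub>F (f \<star>\<^bsub>q\<^esub> g) - q powi (- 2) *\<^sub>F (g \<star>\<^bsub>q\<^esub> f)"

end

(* The products of the letter y with a word v are sums over all insertions of y into v, an
   insertion being weighted by the power of q read off from the prefix before it (for y * v) or
   from the suffix after it (for v * y).  In a commutator the insertions inside a pair xx have
   weight zero, and the insertions into a run yy all give the same word yyy, with weights that
   sum to zero; only insertions at the two ends of v can survive.  Peeling off one block xxyy or
   yyxx at a time turns this into an induction on n. *)
theory Submission
  imports Defs
begin

lemma lookup_scale [simp]: "Poly_Mapping.lookup (c *\<^sub>F f) k = c * Poly_Mapping.lookup f k"
  unfolding scale_def by (simp add: Poly_Mapping.map.rep_eq when_def)

lemma scale_one [simp]: "1 *\<^sub>F f = f"
  by (rule poly_mapping_eqI) simp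

lemma scale_zero_right [simp]: "c *\<^sub>F 0 = 0"
  by (rule poly_mapping_eqI) simp

lemma scale_add_right: "c *\<^sub>F (f + g) = c *\<^sub>F f + c *\<^sub>F g"
  by (rule poly_mapping_eqI) (simp add: lookup_add distrib_left)

lemma scale_diff_right: "c *\<^sub>F (f - g) = c *\<^sub>F f - c *\<^sub>F g"
  by (rule poly_mapping_eqI) (simp add: lookup_minus right_diff_distrib)

lemma scale_scale: "c *\<^sub>F d *\<^sub>F f = (c * d) *\<^sub>F f"
  by (rule poly_mapping_eqI) (simp add: mult.assoc)

lemma word_mult_word: "word u * word v = word (u @ v)"
  by (simp add: word_def mult_single plus_list_def)

lemma word_Nil: "word [] = 1"
  unfolding word_def zero_list_def [symmetric] by (rule single_one)

lemma word_power: "word u ^ n = word (concat (replicate n u))"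
proof (induction n)
  case 0
  show ?case by (simp add: word_Nil)
next
  case (Suc n)
  then show ?case by (simp add: word_mult_word)
qed

lemma mult_scale_right: "f * (c *\<^sub>F g) = c *\<^sub>F (f * g)"
proof (rule poly_mapping_eqI)
  fix k
  have inner: "(\<Sum>v. c * Poly_Mapping.lookup g v when k = u + v)
      = c * (\<Sum>v. Poly_Mapping.lookup g v when k = u + v)" for u
    by (subst Sum_any_right_distrib) (simp_all add: mult_when)
  \<comment> \<open>\<open>Sum_any_right_distrib\<close> needs finite support of the summand; here
    it lies inside the support of \<open>f\<close>.\<close>
  have "finite {u. Poly_Mapping.lookup f u * (\<Sum>v. Poly_Mapping.lookup g v when k = u + v) \<noteq> 0}"
    by (rule finite_subset [OF _ finite_lookup [of f]]) auto
  then show "Poly_Mapping.lookup (f * (c *\<^sub>F g)) k = Poly_Mapping.lookup (c *\<^sub>F (f * g)) k"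
    by (simp add: lookup_mult inner Sum_any_right_distrib mult.left_commute)
qed

lemma qshuffle_word: "word u \<star>\<^bsub>q\<^esub> word v = qshuffle_words q u v"
  by (simp add: qshuffle_def word_def)

lemma mult_word_assoc: "word u * (word v * f) = word (u @ v) * f"
  by (simp add: mult.assoc[symmetric] word_mult_word)

lemma pairing_simps [simp]:
  "pairing a a = 2" "pairing LetterX LetterY = - 2" "pairing LetterY LetterX = - 2"
  by (simp_all add: pairing_def)

lemmas shuffle_simps = word_mult_word mult_word_assoc mult_scale_right scale_add_right
  scale_scale distrib_left

text \<open>The exponent of \<open>q\<close> acquired by a letter y that moves past all of
  \<open>v\<close>; as \<open>pairing\<close> is symmetric, one exponent serves both orders of the
  product.\<close>

abbreviation y_weight :: "letter list \<Rightarrow> int" where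
  "y_weight v \<equiv> (\<Sum>c\<leftarrow>v. pairing LetterY c)"

lemma y_weight_concat_replicate: "y_weight (concat (replicate n v)) = int n * y_weight v"
  by (induction n) (simp_all add: algebra_simps)

(* The condition relating a and b says that the two insertions of y between the letters xx cancel.
   It covers both the q^2-commutator and the plain commutator, for tails v of different weights. *)
lemma shuffle_y_xxyy_step:
  assumes "q \<noteq> 0" and "b * q powi y_weight v = q powi (- 4) * a"
  shows "a *\<^sub>F qshuffle_words q [LetterY] ([LetterX, LetterX, LetterY, LetterY] @ v)
      - b *\<^sub>F qshuffle_words q ([LetterX, LetterX, LetterY, LetterY] @ v) [LetterY]
    = (a * (1 - q powi (- 4))) *\<^sub>F
        (word ([LetterY, LetterX, LetterX, LetterY, LetterY] @ v)
          - word ([LetterX, LetterX, LetterY, LetterY, LetterY] @ v))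
      + word [LetterX, LetterX, LetterY, LetterY] *
        (a *\<^sub>F qshuffle_words q [LetterY] v - b *\<^sub>F qshuffle_words q v [LetterY])"
proof -
  \<comment> \<open>Eliminating \<open>b\<close> leaves every coefficient as \<open>a\<close> times
    a power of \<open>q\<close>, so the cancellations become identities of exponents.\<close>
  have b_eq: "b = a * q powi (- 4 - y_weight v)"
    using assms by (simp add: power_int_diff field_simps)
  show ?thesis
    using assms(1) unfolding b_eq
    by (intro poly_mapping_eqI)
      (simp add: shuffle_simps lookup_add lookup_minus right_diff_distrib power_int_add
        power_int_diff power_int_minus field_simps)
qed

text \<open>Relative to \<open>b\<close>, the insertions before, inside and after yy have weights
  \<open>q^4 - 1\<close>, 0 and \<open>1 - q^4\<close>, all on the word that starts with yyy; the
  insertion inside xx has weight 0. Only insertions into the tail remain.\<close>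

lemma shuffle_yyxx_y_step:
  assumes "q \<noteq> 0" and "a * q powi y_weight v = q powi 4 * b"
  shows "a *\<^sub>F qshuffle_words q ([LetterY, LetterY, LetterX, LetterX] @ v) [LetterY]
      - b *\<^sub>F qshuffle_words q [LetterY] ([LetterY, LetterY, LetterX, LetterX] @ v)
    = word [LetterY, LetterY, LetterX, LetterX] *
        (a *\<^sub>F qshuffle_words q v [LetterY] - b *\<^sub>F qshuffle_words q [LetterY] v)"
proof -
  have a_eq: "a = b * q powi (4 - y_weight v)"
    using assms by (simp add: power_int_diff field_simps)
  show ?thesis
    using assms(1) unfolding a_eq
    by (intro poly_mapping_eqI)
      (simp add: shuffle_simps lookup_add lookup_minus right_diff_distrib power_int_add
        power_int_diff power_int_minus field_simps)
qed

text \<open>The boundary words of consecutive blocks telescope, leaving y before the first block and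
  y after the last.\<close>

lemma shuffle_y_xxyy_power:
  fixes q :: "'f::field"
  assumes "q \<noteq> 0" and "b * q powi y_weight v = q powi (- 4) * a"
  defines "P \<equiv> \<lambda>n. concat (replicate n [LetterX, LetterX, LetterY, LetterY])"
  shows "a *\<^sub>F qshuffle_words q [LetterY] (P n @ v) - b *\<^sub>F qshuffle_words q (P n @ v) [LetterY]
    = (a * (1 - q powi (- 4))) *\<^sub>F (word (LetterY # P n @ v) - word (P n @ LetterY # v))
      + word (P n) * (a *\<^sub>F qshuffle_words q [LetterY] v - b *\<^sub>F qshuffle_words q v [LetterY])"
proof (induction n)
  case 0
  show ?case by (simp add: P_def word_Nil)
next
  case (Suc n)
  have P_Suc: "P (Suc n) = [LetterX, LetterX, LetterY, LetterY] @ P n"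
    by (simp add: P_def)
  \<comment> \<open>A block xxyy has weight zero, so the condition on \<open>v\<close> passes to
    every longer tail.\<close>
  have "b * q powi y_weight (P n @ v) = q powi (- 4) * a"
    using assms(2) by (simp add: P_def y_weight_concat_replicate)
  note step = shuffle_y_xxyy_step [OF assms(1) this]
  show ?case
    unfolding P_Suc append_assoc step Suc.IH
    by (intro poly_mapping_eqI) (simp add: lookup_add lookup_minus shuffle_simps
        right_diff_distrib scale_diff_right)
qed

lemma shuffle_yyxx_y_power:
  fixes q :: "'f::field"
  assumes "q \<noteq> 0" and "a * q powi y_weight v = q powi 4 * b"
  defines "P \<equiv> \<lambda>n. concat (replicate n [LetterY, LetterY, LetterX, LetterX])"
  shows "a *\<^sub>F qshuffle_words q (P n @ v) [LetterY] - b *\<^sub>F qshuffle_words q [LetterY] (P n @ v)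
    = word (P n) * (a *\<^sub>F qshuffle_words q v [LetterY] - b *\<^sub>F qshuffle_words q [LetterY] v)"
proof (induction n)
  case 0
  show ?case by (simp add: P_def word_Nil)
next
  case (Suc n)
  have P_Suc: "P (Suc n) = [LetterY, LetterY, LetterX, LetterX] @ P n"
    by (simp add: P_def)
  have "a * q powi y_weight (P n @ v) = q powi 4 * b"
    using assms(2) by (simp add: P_def y_weight_concat_replicate)
  note step = shuffle_yyxx_y_step [OF assms(1) this]
  show ?case
    unfolding P_Suc append_assoc step Suc.IH by (simp add: mult_word_assoc)
qed

lemma power_mult_shift: "a * (b * a) ^ n = (a * b) ^ n * (a :: 'a :: monoid_mult)"
  by (induction n) (simp_all add: mult.assoc power_commutes)

theorem proposition4p2:
  fixes q :: "'f::field_char_0" and n :: nat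
  assumes "q \<noteq> 0"
    and "\<And>k::nat. k \<ge> 1 \<Longrightarrow> q ^ k \<noteq> 1"
  shows "qshuffle_comm_q2 q gen_y ((gen_x * gen_x * gen_y * gen_y) ^ n)
           = (q powi 2 - q powi (- 2)) *\<^sub>F (gen_y * (gen_x * gen_x * gen_y * gen_y) ^ n)
       \<and> qshuffle_comm_q2 q ((gen_y * gen_y * gen_x * gen_x) ^ n) gen_y
           = (q powi 2 - q powi (- 2)) *\<^sub>F ((gen_y * gen_y * gen_x * gen_x) ^ n * gen_y)
       \<and> qshuffle_comm q gen_y ((gen_x * gen_x * gen_y * gen_y) ^ n * gen_x * gen_x)
           = (1 - q powi (- 4)) *\<^sub>F
               (gen_y * gen_x * gen_x * (gen_y * gen_y * gen_x * gen_x) ^ n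
                - (gen_x * gen_x * gen_y * gen_y) ^ n * gen_x * gen_x * gen_y)
       \<and> qshuffle_comm q ((gen_y * gen_y * gen_x * gen_x) ^ n * gen_y * gen_y) gen_y = 0"
proof -
  let ?X = "concat (replicate n [LetterX, LetterX, LetterY, LetterY])"
  let ?Y = "concat (replicate n [LetterY, LetterY, LetterX, LetterX])"
  have X: "(gen_x * gen_x * gen_y * gen_y) ^ n = (word ?X :: 'f free_alg)"
    and Y: "(gen_y * gen_y * gen_x * gen_x) ^ n = (word ?Y :: 'f free_alg)"
    by (simp_all add: word_mult_word word_power)
  \<comment> \<open>The commutator produces y(xxyy)^n xx; regrouping the letters gives the form in
    the statement.\<close>
  have shift: "gen_y * gen_x * gen_x * word ?Y
      = (word (LetterY # ?X @ [LetterX, LetterX]) :: 'f free_alg)"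
    using power_mult_shift [of "word [LetterX, LetterX] :: 'f free_alg" "word [LetterY, LetterY]" n]
    by (simp add: word_mult_word word_power) (metis append_Cons append_Nil word_mult_word)
  \<comment> \<open>The subscript q^2 means \<open>a = q^2\<close> and \<open>b = q^(-2)\<close>;
    this ratio forces a tail of weight 0, here the empty one. The tail term then cancels the word
    ending in y.\<close>
  have "q powi (- 2) * q powi y_weight [] = q powi (- 4) * q powi 2"
    using \<open>q \<noteq> 0\<close> by (simp add: power_int_minus field_simps)
  note shuffle = shuffle_y_xxyy_power [OF \<open>q \<noteq> 0\<close> this, of n, unfolded append_Nil2]
  have 1: "qshuffle_comm_q2 q gen_y (word ?X)
      = (q powi 2 - q powi (- 2)) *\<^sub>F word (LetterY # ?X)"
    unfolding qshuffle_comm_q2_def qshuffle_word shuffle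
    using \<open>q \<noteq> 0\<close>
    by (intro poly_mapping_eqI) (simp add: lookup_add lookup_minus shuffle_simps right_diff_distrib
        power_int_minus field_simps)
  have "q powi 2 * q powi y_weight [] = q powi 4 * q powi (- 2)"
    using \<open>q \<noteq> 0\<close> by (simp add: power_int_minus field_simps)
  note shuffle = shuffle_yyxx_y_power [OF \<open>q \<noteq> 0\<close> this, of n, unfolded append_Nil2]
  have 2: "qshuffle_comm_q2 q (word ?Y) gen_y
      = (q powi 2 - q powi (- 2)) *\<^sub>F word (?Y @ [LetterY])"
    unfolding qshuffle_comm_q2_def qshuffle_word shuffle
    by (intro poly_mapping_eqI) (simp add: lookup_minus shuffle_simps right_diff_distrib
        left_diff_distrib)
  \<comment> \<open>For a plain commutator \<open>a = b = 1\<close>, which forces a tail of weight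
    -4: the word xx. Its own commutator with y moves the right-hand y from before xx to after
    it.\<close>
  have "1 * q powi y_weight [LetterX, LetterX] = q powi (- 4) * 1"
    by simp
  note shuffle = shuffle_y_xxyy_power [OF \<open>q \<noteq> 0\<close> this, of n, unfolded scale_one]
  have 3: "qshuffle_comm q gen_y (word (?X @ [LetterX, LetterX]))
      = (1 - q powi (- 4)) *\<^sub>F
        (word (LetterY # ?X @ [LetterX, LetterX]) - word (?X @ [LetterX, LetterX, LetterY]))"
    unfolding qshuffle_comm_def qshuffle_word shuffle
    using \<open>q \<noteq> 0\<close>
    by (intro poly_mapping_eqI) (simp add: lookup_add lookup_minus shuffle_simps right_diff_distrib
        power_int_minus field_simps)
  \<comment> \<open>Now the tail must have weight 4: the word yy, which commutes with y.\<close>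
  have "1 * q powi y_weight [LetterY, LetterY] = q powi 4 * 1"
    by simp
  note shuffle = shuffle_yyxx_y_power [OF \<open>q \<noteq> 0\<close> this, of n, unfolded scale_one]
  have 4: "qshuffle_comm q (word (?Y @ [LetterY, LetterY])) gen_y = 0"
    unfolding qshuffle_comm_def qshuffle_word shuffle
    by (intro poly_mapping_eqI) (simp add: lookup_add lookup_minus shuffle_simps right_diff_distrib
        algebra_simps)
  show ?thesis
    using 1 2 3 4 unfolding X Y shift by (simp add: word_mult_word)
qed

end
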